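(* Let $\Omega$, $p,q$, $k_0$, $k_\star$, $\mathcal{V}_0$, $\mathcal{V}_\star$, and $\mathcal{V}=\mathcal{V}_0+\mathcal{V}_\star$ be as in the context. Suppose that there are real constants $\tau>0$, $\gamma>0$, $\lambda_\Delta$ and a constant $M$ such that: (i) $k_0(a,a)-\tau/a$ is bounded on a neighborhood of $0$ in $\Omega$, and for each $\sigma>\tau$ there is a neighborhood of $(0,0)$ in $\Omega^2$ on which $|k_0(a,a')|<\sigma/|a|$; (ii) $|k_0(a,a')|\le \dfrac{M}{|a|}\,e^{\lambda_\Delta|a-a'|}$ for all $a,a'\in\Omega$; (iii) $|k_\star(a,a')|\le M\,\dfrac{|a-a'|^\gamma}{|a|}\,e^{\lambda_\Delta|a-a'|}$ for all $a,a'\in\Omega$. Fix $b\in\Omega$ and let $f_0(a)=\frac{1}{p(a)}\exp\left(-\int_b^a\frac{q(s)}{p(s)}\,ds\right)$. Then, for any $\rho>\tau$, the equation $f=\mathcal{V}f$ has at most one solution $f$ in $f_0+\mathcal{H}L^\infty_{\rho-1,\bullet}(\Omega)$.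
   Context: $\Omega\subset\mathbb{C}$ is a simply connected open set with $0\notin\Omega$ and $0\in\overline{\Omega}$, star-shaped around $0$: for every $a\in\Omega$ the segment $\{ta: 0<t\le 1\}$ lies in $\Omega$. $\mathcal{H}(\Omega)$ is the space of holomorphic functions on $\Omega$. The functions $p,q\in\mathcal{H}(\Omega)$ are such that $k_0(a,a')=-q(a')/p(a)$ is holomorphic on $\Omega^2$ (so $p$ has no zeros in $\Omega$ when $q\not\equiv0$), and $k_\star$ is a holomorphic function on $\Omega^2$. The Volterra operators are $[\mathcal{V}_0\varphi](a)=\int_0^a k_0(a,a')\varphi(a')\,da'$ and $[\mathcal{V}_\star\varphi](a)=\int_0^a k_\star(a,a')\varphi(a')\,da'$. Integrals $\int_0^a$ are (possibly improper at $0$) integrals along the straight segment from $0$ to $a$. Integrals $\int_b^a$ with $b\in\Omega$ are taken along any path in $\Omega$. A neighborhood of $0$ in $\Omega$ means $U\cap\Omega$ with $U\subset\mathbb{C}$ an open neighborhood of $0$, and similarly a neighborhood of $(0,0)$ in $\Omega^2$ means $U\cap\Omega^2$ with $U\subset\mathbb{C}^2$ an open neighborhood of $(0,0)$. For $\sigma,\Lambda\in\mathbb{R}$, $\mathcal{H}L^\infty_{\sigma,\Lambda}(\Omega)$ is the space of $f\in\mathcal{H}(\Omega)$ with $\|f\|_{\sigma,\Lambda}:=\sup_{a\in\Omega}|a|^{-\sigma}e^{-\Lambda|a|}|f(a)|<\infty$, and $\mathcal{H}L^\infty_{\sigma,\bullet}(\Omega)=\bigcup_{\Lambda\in\mathbb{R}}\mathcal{H}L^\infty_{\sigma,\Lambda}(\Omega)$.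 *)

theory Defs
  imports "HOL-Complex_Analysis.Complex_Analysis"
begin

definition star_shaped_at_0 :: "complex set \<Rightarrow> bool" where
  "star_shaped_at_0 \<Omega> \<longleftrightarrow> (\<forall>a\<in>\<Omega>. \<forall>t::real. 0 < t \<and> t \<le> 1 \<longrightarrow> of_real t * a \<in> \<Omega>)"

text \<open>Holomorphy in two variables: the Frechet derivative exists and is complex linear.\<close>

definition holomorphic2_on ::
    "(complex \<Rightarrow> complex \<Rightarrow> complex) \<Rightarrow> (complex \<times> complex) set \<Rightarrow> bool" where
  "holomorphic2_on k W \<longleftrightarrow>
     (\<forall>z\<in>W. \<exists>c d. ((\<lambda>(a, a'). k a a') has_derivative (\<lambda>(h, h'). c * h + d * h')) (at z within W))"

text \<open>
  Contour integrals are gauge (Henstock-Kurzweil) integrals over the parameter interval. For an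
  integrand that is continuous on the segment away from \<open>0\<close>, integrability on \<open>linepath 0 a\<close> is
  therefore the same as convergence of the improper integral at \<open>0\<close> (Hake's theorem), with the
  same value; the value of the integrand at \<open>0\<close> plays no role.
\<close>

definition volterra_defined ::
    "(complex \<Rightarrow> complex \<Rightarrow> complex) \<Rightarrow> (complex \<Rightarrow> complex) \<Rightarrow> complex \<Rightarrow> bool" where
  "volterra_defined k \<phi> a \<longleftrightarrow> (\<lambda>a'. k a a' * \<phi> a') contour_integrable_on linepath 0 a"

definition volterra ::
    "(complex \<Rightarrow> complex \<Rightarrow> complex) \<Rightarrow> (complex \<Rightarrow> complex) \<Rightarrow> complex \<Rightarrow> complex" where
  "volterra k \<phi> a = contour_integral (linepath 0 a) (\<lambda>a'. k a a' * \<phi> a')"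

text \<open>
  Despite \<open>x / 0 = 0\<close>, holomorphy of \<open>k0 p q\<close> on \<open>\<Omega> \<times> \<Omega>\<close> rules out zeros of \<open>p\<close> unless \<open>k0 p q\<close> vanishes
  identically: if \<open>q a' \<noteq> 0\<close>, then \<open>k0 p q a a'\<close> is unbounded in \<open>a\<close> near an isolated zero of \<open>p\<close>.
\<close>

definition k0 :: "(complex \<Rightarrow> complex) \<Rightarrow> (complex \<Rightarrow> complex) \<Rightarrow> complex \<Rightarrow> complex \<Rightarrow> complex" where
  "k0 p q a a' = - q a' / p a"

definition path_integral ::
    "complex set \<Rightarrow> complex \<Rightarrow> complex \<Rightarrow> (complex \<Rightarrow> complex) \<Rightarrow> complex" where
  "path_integral \<Omega> b a g = contour_integral
     (SOME \<gamma>. valid_path \<gamma> \<and> path_image \<gamma> \<subseteq> \<Omega> \<and> pathstart \<gamma> = b \<and> pathfinish \<gamma> = a) g"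

lemma path_integral_eq:
  assumes "open \<Omega>" "simply_connected \<Omega>" "g holomorphic_on \<Omega>"
    and "valid_path \<gamma>" "path_image \<gamma> \<subseteq> \<Omega>" "pathstart \<gamma> = b" "pathfinish \<gamma> = a"
  shows "path_integral \<Omega> b a g = contour_integral \<gamma> g"
proof -
  obtain F where F: "\<And>z. z \<in> \<Omega> \<Longrightarrow> (F has_field_derivative g z) (at z)"
    using assms(1-3) simply_connected_eq_global_primitive by blast
  let ?P = "\<lambda>\<eta>. valid_path \<eta> \<and> path_image \<eta> \<subseteq> \<Omega> \<and> pathstart \<eta> = b \<and> pathfinish \<eta> = a"
  have *: "contour_integral \<eta> g = F a - F b" if \<eta>: "?P \<eta>" for \<eta>
  proof -
    have "(g has_contour_integral (F (pathfinish \<eta>) - F (pathstart \<eta>))) \<eta>"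
      by (rule contour_integral_primitive[of \<Omega>])
        (use F \<eta> in \<open>auto intro: has_field_derivative_at_within\<close>)
    then show ?thesis using \<eta> by (simp add: contour_integral_unique)
  qed
  have P: "?P \<gamma>" using assms(4-7) by blast
  then have "?P (SOME \<eta>. ?P \<eta>)" by (rule someI[where P = ?P])
  then show ?thesis unfolding path_integral_def using *[OF P] * by presburger
qed

definition f0 ::
    "complex set \<Rightarrow> (complex \<Rightarrow> complex) \<Rightarrow> (complex \<Rightarrow> complex) \<Rightarrow> complex \<Rightarrow> complex \<Rightarrow> complex" where
  "f0 \<Omega> p q b a = 1 / p a * exp (- path_integral \<Omega> b a (\<lambda>s. q s / p s))"

definition HL_inf :: "real \<Rightarrow> real \<Rightarrow> complex set \<Rightarrow> (complex \<Rightarrow> complex) set" where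
  "HL_inf \<sigma> \<Lambda> \<Omega> = {f. f holomorphic_on \<Omega> \<and>
     bdd_above ((\<lambda>a. norm a powr (- \<sigma>) * exp (- \<Lambda> * norm a) * norm (f a)) ` \<Omega>)}"

definition HL_inf_bullet :: "real \<Rightarrow> complex set \<Rightarrow> (complex \<Rightarrow> complex) set" where
  "HL_inf_bullet \<sigma> \<Omega> = (\<Union>\<Lambda>. HL_inf \<sigma> \<Lambda> \<Omega>)"

text \<open>Being a solution includes the convergence of the integrals defining both operators.\<close>

definition volterra_solution ::
    "complex set \<Rightarrow> (complex \<Rightarrow> complex \<Rightarrow> complex) \<Rightarrow> (complex \<Rightarrow> complex \<Rightarrow> complex) \<Rightarrow>
     (complex \<Rightarrow> complex) \<Rightarrow> bool" where
  "volterra_solution \<Omega> k k' f \<longleftrightarrow>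
     (\<forall>a\<in>\<Omega>. volterra_defined k f a \<and> volterra_defined k' f a \<and>
            f a = volterra k f a + volterra k' f a)"

end

theory Submission
  imports Defs
begin

text \<open>
  The difference \<open>h\<close> of two solutions solves the homogeneous equation and is
  \<open>O(|a| powr (\<rho> - 1))\<close> at \<open>0\<close>. For \<open>\<tau> < \<sigma> < \<rho>\<close>, close to \<open>0\<close> the operator multiplies the best
  constant \<open>N\<close> in \<open>|h a| \<le> N |a| powr (\<rho> - 1)\<close> by at most \<open>(\<sigma> + C |a| powr \<gamma>) / \<rho> < 1\<close>, which forces
  \<open>N = 0\<close>. So \<open>h\<close> vanishes near \<open>0\<close>, and then on all of \<open>\<Omega>\<close> by analytic continuation.
\<close>

text \<open>On the segment \<open>a' = t * a\<close> the operator becomes \<open>a\<close> times an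
  integral over \<open>{0..1}\<close>, and \<open>t powr (\<rho> - 1)\<close> integrates to
  \<open>1 / \<rho>\<close> there. This \<open>1 / \<rho>\<close> is the source of the
  contraction.\<close>

lemma norm_volterra_le:
  assumes def: "volterra_defined k \<phi> a" and "\<rho> > 0"
    and bound: "\<And>t. 0 < t \<Longrightarrow> t \<le> 1 \<Longrightarrow>
      norm (k a (of_real t * a) * \<phi> (of_real t * a)) \<le> B * t powr (\<rho> - 1)"
  shows "norm (volterra k \<phi> a) \<le> norm a * B / \<rho>"
proof -
  let ?f = "\<lambda>t. k a (of_real t * a) * \<phi> (of_real t * a) * a"
  \<comment> \<open>The bound is assumed for \<open>t > 0\<close> only. Resetting the integrand at
    the single point \<open>0\<close> leaves the integral unchanged and makes the bound hold on all
    of \<open>{0..1}\<close>.\<close>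
  let ?g = "\<lambda>t. if t = 0 then 0 else ?f t"
  have lin: "linepath 0 a t = of_real t * a" for t
    by (simp add: linepath_def scaleR_conv_of_real)
  have "(?f has_integral volterra k \<phi> a) {0..1}"
    using has_contour_integral_integral[OF def[unfolded volterra_defined_def]]
    unfolding has_contour_integral_linepath by (simp add: volterra_def lin scaleR_conv_of_real)
  then have g: "(?g has_integral volterra k \<phi> a) {0..1}"
    by (rule has_integral_spike_finite[where S = "{0}", rotated 2]) auto
  \<comment> \<open>Since \<open>\<rho> - 1 > -1\<close>, the power is integrable at
    \<open>0\<close> even when \<open>\<rho> < 1\<close>.\<close>
  have "((\<lambda>t. t powr (\<rho> - 1)) has_integral (1 powr (\<rho> - 1 + 1) / (\<rho> - 1 + 1))) {0..1}"
    using \<open>\<rho> > 0\<close> by (intro has_integral_powr_from_0) auto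
  from has_integral_mult_right[OF this, of "norm a * B"]
  have p: "((\<lambda>t. norm a * B * t powr (\<rho> - 1)) has_integral (norm a * B / \<rho>)) {0..1}"
    by simp
  have "norm (integral {0..1} ?g) \<le> integral {0..1} (\<lambda>t. norm a * B * t powr (\<rho> - 1))"
  proof (rule integral_norm_bound_integral)
    show "norm (?g t) \<le> norm a * B * t powr (\<rho> - 1)" if "t \<in> {0..1}" for t
      using that mult_left_mono[OF bound[of t] norm_ge_zero[of a]]
      by (auto simp: norm_mult mult_ac)
  qed (use g p in blast)+
  then show ?thesis
    using integral_unique[OF g] integral_unique[OF p] by simp
qed

lemma volterra_solution_diff:
  assumes "volterra_solution \<Omega> k k' f" "volterra_solution \<Omega> k k' g"
  shows "volterra_solution \<Omega> k k' (\<lambda>a. f a - g a)"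
  using assms
  by (simp add: volterra_solution_def volterra_defined_def volterra_def right_diff_distrib
      contour_integral_diff contour_integrable_diff)

lemma HL_inf_bulletE:
  assumes "f \<in> HL_inf_bullet \<sigma> \<Omega>"
  obtains \<Lambda> B where "f holomorphic_on \<Omega>"
    and "\<And>a. a \<in> \<Omega> \<Longrightarrow> norm a powr (- \<sigma>) * exp (- \<Lambda> * norm a) * norm (f a) \<le> B"
  using assms unfolding HL_inf_bullet_def HL_inf_def bdd_above_def by blast

lemma HL_inf_bullet_diff:
  assumes "f \<in> HL_inf_bullet \<sigma> \<Omega>" "g \<in> HL_inf_bullet \<sigma> \<Omega>"
  shows "(\<lambda>a. f a - g a) \<in> HL_inf_bullet \<sigma> \<Omega>"
proof -
  let ?w = "\<lambda>\<Lambda> a. norm a powr (- \<sigma>) * exp (- \<Lambda> * norm a)"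
  obtain \<Lambda> B where f: "f holomorphic_on \<Omega>"
    and B: "\<And>a. a \<in> \<Omega> \<Longrightarrow> ?w \<Lambda> a * norm (f a) \<le> B"
    by (rule HL_inf_bulletE[OF assms(1)]) blast
  obtain \<Lambda>' B' where g: "g holomorphic_on \<Omega>"
    and B': "\<And>a. a \<in> \<Omega> \<Longrightarrow> ?w \<Lambda>' a * norm (g a) \<le> B'"
    by (rule HL_inf_bulletE[OF assms(2)]) blast
  \<comment> \<open>The two functions may come with different exponents. A larger exponent gives a
    smaller weight, so the maximum serves both.\<close>
  let ?L = "max \<Lambda> \<Lambda>'"
  have "?w ?L a * norm (f a - g a) \<le> B + B'" if "a \<in> \<Omega>" for a
  proof -
    have w: "?w ?L a \<le> ?w \<Lambda> a" "?w ?L a \<le> ?w \<Lambda>' a"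
      by (simp_all add: mult_left_mono mult_right_mono)
    have "?w ?L a * norm (f a - g a) \<le> ?w ?L a * (norm (f a) + norm (g a))"
      by (rule mult_left_mono[OF norm_triangle_ineq4]) simp
    also have "\<dots> = ?w ?L a * norm (f a) + ?w ?L a * norm (g a)"
      by (rule distrib_left)
    also have "\<dots> \<le> ?w \<Lambda> a * norm (f a) + ?w \<Lambda>' a * norm (g a)"
      by (rule add_mono; rule mult_right_mono[OF _ norm_ge_zero]; rule w)
    also have "\<dots> \<le> B + B'"
      by (rule add_mono[OF B[OF that] B'[OF that]])
    finally show ?thesis .
  qed
  then have "bdd_above ((\<lambda>a. ?w ?L a * norm (f a - g a)) ` \<Omega>)"
    by (rule bdd_aboveI2)
  then have "(\<lambda>a. f a - g a) \<in> HL_inf \<sigma> ?L \<Omega>"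
    using holomorphic_on_diff[OF f g] unfolding HL_inf_def by simp
  then show ?thesis
    unfolding HL_inf_bullet_def by blast
qed

text \<open>On a bounded set the exponential weight is bounded away from \<open>0\<close>, so it can
  be absorbed into the constant and only the power weight remains.\<close>

lemma HL_inf_bullet_bounded_near_0:
  assumes "h \<in> HL_inf_bullet \<sigma> \<Omega>"
  shows "bdd_above ((\<lambda>a. norm a powr (- \<sigma>) * norm (h a)) ` (\<Omega> \<inter> ball 0 \<delta>))"
proof -
  obtain \<Lambda> B where B: "\<And>a. a \<in> \<Omega> \<Longrightarrow> norm a powr (- \<sigma>) * exp (- \<Lambda> * norm a) * norm (h a) \<le> B"
    by (rule HL_inf_bulletE[OF assms]) blast
  have "norm a powr (- \<sigma>) * norm (h a) \<le> exp (\<bar>\<Lambda>\<bar> * \<delta>) * \<bar>B\<bar>" if "a \<in> \<Omega> \<inter> ball 0 \<delta>" for a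
  proof -
    have e: "\<Lambda> * norm a \<le> \<bar>\<Lambda>\<bar> * \<delta>"
      using that by (intro mult_mono) auto
    have "norm a powr (- \<sigma>) * norm (h a)
        = exp (\<Lambda> * norm a) * (norm a powr (- \<sigma>) * exp (- \<Lambda> * norm a) * norm (h a))"
      by (simp add: exp_minus field_simps)
    also have "\<dots> \<le> exp (\<bar>\<Lambda>\<bar> * \<delta>) * \<bar>B\<bar>"
      using B[of a] that e by (intro mult_mono) auto
    finally show ?thesis .
  qed
  then show ?thesis
    by (meson bdd_aboveI2)
qed

text \<open>One application of the equation improves the bound on \<open>h\<close>: the length
  \<open>norm a\<close> of the segment cancels the factor \<open>1 / norm a\<close> of the kernels,
  and integrating the power contributes \<open>1 / \<rho>\<close>.\<close>

lemma solution_bound_step: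
  fixes h :: "complex \<Rightarrow> complex"
  assumes sol: "volterra_solution \<Omega> k k' h"
    and a: "a \<in> \<Omega>" "a \<noteq> 0" and "\<rho> > 0" "N \<ge> 0" "\<kappa> \<ge> 0" "\<kappa>' \<ge> 0"
    and h: "\<And>t. 0 < t \<Longrightarrow> t \<le> 1 \<Longrightarrow>
      norm (h (of_real t * a)) \<le> N * norm (of_real t * a) powr (\<rho> - 1)"
    and k: "\<And>t. 0 < t \<Longrightarrow> t \<le> 1 \<Longrightarrow> norm (k a (of_real t * a)) \<le> \<kappa> / norm a"
    and k': "\<And>t. 0 < t \<Longrightarrow> t \<le> 1 \<Longrightarrow> norm (k' a (of_real t * a)) \<le> \<kappa>' / norm a"
  shows "norm (h a) \<le> (\<kappa> + \<kappa>') / \<rho> * N * norm a powr (\<rho> - 1)"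
proof -
  \<comment> \<open>A single estimate for a generic kernel \<open>l\<close> covers both
    operators.\<close>
  have *: "norm (volterra l h a) \<le> c / \<rho> * N * norm a powr (\<rho> - 1)"
    if "volterra_defined l h a" "c \<ge> 0"
      and l: "\<And>t. 0 < t \<Longrightarrow> t \<le> 1 \<Longrightarrow> norm (l a (of_real t * a)) \<le> c / norm a" for l c
  proof -
    have "norm (volterra l h a) \<le> norm a * (c / norm a * N * norm a powr (\<rho> - 1)) / \<rho>"
    proof (rule norm_volterra_le[OF that(1) \<open>\<rho> > 0\<close>])
      fix t :: real assume t: "0 < t" "t \<le> 1"
      have "norm (l a (of_real t * a) * h (of_real t * a))
          \<le> c / norm a * (N * norm (of_real t * a) powr (\<rho> - 1))"
        unfolding norm_mult[of "l _ _"] using l[OF t] h[OF t] \<open>c \<ge> 0\<close> by (intro mult_mono) auto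
      also have "\<dots> = c / norm a * N * norm a powr (\<rho> - 1) * t powr (\<rho> - 1)"
        using t by (simp add: norm_mult powr_mult)
      finally show "norm (l a (of_real t * a) * h (of_real t * a))
          \<le> c / norm a * N * norm a powr (\<rho> - 1) * t powr (\<rho> - 1)" .
    qed
    then show ?thesis
      using \<open>a \<noteq> 0\<close> by (simp add: mult_ac)
  qed
  have "norm (h a) \<le> norm (volterra k h a) + norm (volterra k' h a)"
    using sol a unfolding volterra_solution_def by (metis norm_triangle_ineq)
  also have "\<dots> \<le> \<kappa> / \<rho> * N * norm a powr (\<rho> - 1) + \<kappa>' / \<rho> * N * norm a powr (\<rho> - 1)"
    using sol a assms(6,7) k k' unfolding volterra_solution_def by (intro add_mono *) auto
  also have "\<dots> = (\<kappa> + \<kappa>') / \<rho> * N * norm a powr (\<rho> - 1)"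
    by (simp add: add_divide_distrib algebra_simps)
  finally show ?thesis .
qed

text \<open>The part of \<open>\<Omega>\<close> in the ball contains the segments from
  \<open>0\<close> to its points, so the improved bound applies to the supremum \<open>N\<close> of
  the weighted values itself: \<open>N\<close> is at most a factor below \<open>1\<close> times
  \<open>N\<close>.\<close>

lemma homogeneous_solution_zero_near_0:
  fixes h :: "complex \<Rightarrow> complex"
  assumes "0 \<notin> \<Omega>" and star: "star_shaped_at_0 \<Omega>" and sol: "volterra_solution \<Omega> k k' h"
    and h: "h \<in> HL_inf_bullet (\<rho> - 1) \<Omega>" and "\<rho> > 0" "\<kappa> \<ge> 0" "\<kappa>' \<ge> 0" "\<kappa> + \<kappa>' < \<rho>"
    and k: "\<And>a a'. a \<in> \<Omega> \<inter> ball 0 \<delta> \<Longrightarrow> a' \<in> \<Omega> \<inter> ball 0 \<delta> \<Longrightarrow> norm (k a a') \<le> \<kappa> / norm a"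
    and k': "\<And>a t. a \<in> \<Omega> \<inter> ball 0 \<delta> \<Longrightarrow> 0 < t \<Longrightarrow> t \<le> 1 \<Longrightarrow>
      norm (k' a (of_real t * a)) \<le> \<kappa>' / norm a"
    and a: "a \<in> \<Omega> \<inter> ball 0 \<delta>"
  shows "h a = 0"
proof -
  let ?S = "\<Omega> \<inter> ball 0 \<delta>"
  let ?w = "\<lambda>a. norm a powr (- (\<rho> - 1)) * norm (h a)"
  define N where "N = (SUP a\<in>?S. ?w a)"
  \<comment> \<open>Finiteness of \<open>N\<close> is where the growth condition on \<open>h\<close>
    enters; an infinite supremum would allow no contraction argument.\<close>
  have bdd: "bdd_above (?w ` ?S)"
    using HL_inf_bullet_bounded_near_0[OF h] .
  have w_le: "?w x \<le> N" if "x \<in> ?S" for x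
    unfolding N_def using that bdd by (rule cSUP_upper)
  have N0: "N \<ge> 0"
    using w_le[OF a] by (smt (verit) mult_nonneg_nonneg norm_ge_zero powr_ge_zero)
  have nz: "x \<noteq> 0" if "x \<in> ?S" for x
    using that \<open>0 \<notin> \<Omega>\<close> by auto
  have w_iff: "?w x \<le> C \<longleftrightarrow> norm (h x) \<le> C * norm x powr (\<rho> - 1)" if "x \<in> ?S" for x C
  proof -
    have "0 < norm x powr (\<rho> - 1)"
      using nz[OF that] by simp
    then show ?thesis
      unfolding powr_minus by (simp add: field_simps)
  qed
  have S: "of_real t * x \<in> ?S" if "x \<in> ?S" "0 < t" "t \<le> 1" for x and t :: real
  proof -
    have "t * norm x \<le> norm x"
      using that by (simp add: mult_left_le_one_le)
    then show ?thesis
      using that star unfolding star_shaped_at_0_def by (auto simp: norm_mult)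
  qed
  have step: "?w x \<le> (\<kappa> + \<kappa>') / \<rho> * N" if x: "x \<in> ?S" for x
    unfolding w_iff[OF x]
  proof (rule solution_bound_step[OF sol])
    show "norm (h (of_real t * x)) \<le> N * norm (of_real t * x) powr (\<rho> - 1)"
      if "0 < t" "t \<le> 1" for t
      using w_le[OF S[OF x that]] w_iff[OF S[OF x that]] by blast
  qed (use x nz N0 assms k k' S in auto)
  \<comment> \<open>Passing to the least upper bound requires a nonempty set; the given point
    \<open>a\<close> provides this.\<close>
  have "N \<le> (\<kappa> + \<kappa>') / \<rho> * N"
    unfolding N_def[symmetric] using step a by (subst N_def) (intro cSUP_least; blast)
  moreover have "(\<kappa> + \<kappa>') / \<rho> < 1"
    using assms by simp
  ultimately have "N = 0"
    using N0 by (smt (verit) mult_less_cancel_right2)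
  then show ?thesis
    using w_le[OF a] w_iff[OF a, of 0] by simp
qed

theorem corollary1p7:
  fixes \<Omega> :: "complex set"
    and p q :: "complex \<Rightarrow> complex"
    and kstar :: "complex \<Rightarrow> complex \<Rightarrow> complex"
    and \<tau> \<gamma> lam M \<rho> :: real
    and b :: complex
  assumes "open \<Omega>" and "simply_connected \<Omega>" and "0 \<notin> \<Omega>" and "0 \<in> closure \<Omega>"
    and "star_shaped_at_0 \<Omega>"
    and "p holomorphic_on \<Omega>" and "q holomorphic_on \<Omega>"
    and "holomorphic2_on (k0 p q) (\<Omega> \<times> \<Omega>)"
    and "holomorphic2_on kstar (\<Omega> \<times> \<Omega>)"
    and "\<tau> > 0" and "\<gamma> > 0"
    and "\<exists>U. open U \<and> 0 \<in> U \<and> bounded ((\<lambda>a. k0 p q a a - of_real \<tau> / a) ` (U \<inter> \<Omega>))"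
    and "\<And>\<sigma>. \<sigma> > \<tau> \<Longrightarrow> \<exists>U. open U \<and> (0, 0) \<in> U \<and>
           (\<forall>(a, a') \<in> U \<inter> \<Omega> \<times> \<Omega>. norm (k0 p q a a') < \<sigma> / norm a)"
    and "\<And>a a'. a \<in> \<Omega> \<Longrightarrow> a' \<in> \<Omega> \<Longrightarrow>
           norm (k0 p q a a') \<le> M / norm a * exp (lam * norm (a - a'))"
    and "\<And>a a'. a \<in> \<Omega> \<Longrightarrow> a' \<in> \<Omega> \<Longrightarrow>
           norm (kstar a a') \<le> M * (norm (a - a') powr \<gamma> / norm a) * exp (lam * norm (a - a'))"
    and "b \<in> \<Omega>"
    and "\<rho> > \<tau>"
  shows "\<forall>f g.
           (\<lambda>a. f a - f0 \<Omega> p q b a) \<in> HL_inf_bullet (\<rho> - 1) \<Omega> \<and>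
           volterra_solution \<Omega> (k0 p q) kstar f \<and>
           (\<lambda>a. g a - f0 \<Omega> p q b a) \<in> HL_inf_bullet (\<rho> - 1) \<Omega> \<and>
           volterra_solution \<Omega> (k0 p q) kstar g
           \<longrightarrow> (\<forall>a\<in>\<Omega>. f a = g a)"
proof (intro allI impI; elim conjE)
  fix f g :: "complex \<Rightarrow> complex"
  assume f: "(\<lambda>a. f a - f0 \<Omega> p q b a) \<in> HL_inf_bullet (\<rho> - 1) \<Omega>"
    and g: "(\<lambda>a. g a - f0 \<Omega> p q b a) \<in> HL_inf_bullet (\<rho> - 1) \<Omega>"
    and sols: "volterra_solution \<Omega> (k0 p q) kstar f" "volterra_solution \<Omega> (k0 p q) kstar g"
  define h where "h = (\<lambda>a. f a - g a)"
  have sol: "volterra_solution \<Omega> (k0 p q) kstar h"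
    unfolding h_def using sols by (rule volterra_solution_diff)
  \<comment> \<open>The common term \<open>f0\<close> cancels in the difference.\<close>
  have h: "h \<in> HL_inf_bullet (\<rho> - 1) \<Omega>"
    using HL_inf_bullet_diff[OF f g] by (simp add: h_def)
  then have hol: "h holomorphic_on \<Omega>"
    by (rule HL_inf_bulletE)
  \<comment> \<open>The midpoint is above \<open>\<tau>\<close>, so the local bound on
    \<open>k0\<close> is available, and leaves a gap below \<open>\<rho>\<close> for the
    contribution of \<open>kstar\<close>.\<close>
  define \<sigma> where "\<sigma> = (\<tau> + \<rho>) / 2"
  have \<sigma>: "\<tau> < \<sigma>" "\<sigma> < \<rho>" "0 < \<sigma>"
    using assms(10,17) by (auto simp: \<sigma>_def)
  \<comment> \<open>For points at distance at most \<open>1\<close>, \<open>C\<close> dominates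
    \<open>M\<close> times the exponential factor, whatever the signs of \<open>M\<close> and
    \<open>lam\<close>.\<close>
  define C where "C = \<bar>M\<bar> * exp \<bar>lam\<bar>"
  obtain U where U: "open U" "(0, 0) \<in> U"
    "\<And>a a'. (a, a') \<in> U \<Longrightarrow> a \<in> \<Omega> \<Longrightarrow> a' \<in> \<Omega> \<Longrightarrow> norm (k0 p q a a') < \<sigma> / norm a"
    using assms(13)[OF \<sigma>(1)] by blast
  \<comment> \<open>A product neighbourhood inside \<open>U\<close> yields one radius that works for
    both variables.\<close>
  obtain A A' where A: "open A" "open A'" "(0, 0) \<in> A \<times> A'" "A \<times> A' \<subseteq> U"
    by (rule open_prod_elim[OF U(1,2)])
  obtain \<delta>1 where \<delta>1: "\<delta>1 > 0" "ball 0 \<delta>1 \<subseteq> A \<inter> A'"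
    using openE[OF open_Int[OF A(1,2)], of 0] A(3) by blast
  \<comment> \<open>Half of the gap is allotted to \<open>kstar\<close>, which keeps
    \<open>\<sigma> + \<kappa> < \<rho>\<close> strict.\<close>
  define \<kappa> where "\<kappa> = (\<rho> - \<sigma>) / 2"
  \<comment> \<open>Because \<open>\<gamma> > 0\<close>, the contribution of \<open>kstar\<close>
    tends to \<open>0\<close> with the radius, so a small enough \<open>\<delta>\<close> brings it
    below \<open>\<kappa>\<close>.\<close>
  have "((\<lambda>d. C * d powr \<gamma>) \<longlongrightarrow> C * 0 powr \<gamma>) (at_right 0)"
    using \<open>\<gamma> > 0\<close> eventually_at_right_less[of "0::real"]
    by (intro tendsto_intros tendsto_powr') (auto elim: eventually_mono)
  then have "\<forall>\<^sub>F d in at_right 0. C * d powr \<gamma> < \<kappa>"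
    using \<sigma> by (intro order_tendstoD) (auto simp: \<kappa>_def)
  moreover have "\<forall>\<^sub>F d in at_right 0. d < min 1 \<delta>1"
    using \<delta>1 by (intro order_tendstoD(2)[OF tendsto_ident_at]) auto
  moreover have "\<forall>\<^sub>F d in at_right 0. (d :: real) > 0"
    by (rule eventually_at_right_less)
  ultimately have "\<forall>\<^sub>F d in at_right 0. C * d powr \<gamma> < \<kappa> \<and> d < 1 \<and> d < \<delta>1 \<and> d > 0"
    by eventually_elim auto
  then obtain \<delta> where \<delta>: "C * \<delta> powr \<gamma> < \<kappa>" "\<delta> < 1" "\<delta> < \<delta>1" "\<delta> > 0"
    using eventually_happens[of _ "at_right (0::real)"] trivial_limit_at_right_real by blast
  have zero: "h a = 0" if "a \<in> \<Omega> \<inter> ball 0 \<delta>" for a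
  proof (rule homogeneous_solution_zero_near_0[OF assms(3,5) sol h, of \<sigma> \<kappa> \<delta>])
    fix a a' assume "a \<in> \<Omega> \<inter> ball 0 \<delta>" "a' \<in> \<Omega> \<inter> ball 0 \<delta>"
    moreover from this have "(a, a') \<in> U"
      using \<delta>1(2) \<delta>(3) A(4) by (auto simp: subset_iff)
    ultimately show "norm (k0 p q a a') \<le> \<sigma> / norm a"
      using U(3) by (simp add: less_imp_le)
  next
    fix a :: complex and t :: real assume a: "a \<in> \<Omega> \<inter> ball 0 \<delta>" and t: "0 < t" "t \<le> 1"
    \<comment> \<open>On the segment the distance to \<open>a\<close> is at most
      \<open>norm a\<close>, hence at most \<open>\<delta> < 1\<close>; this controls both the power
      and the exponential in the bound on \<open>kstar\<close>.\<close>
    have "a - of_real t * a = of_real (1 - t) * a"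
      by (simp add: algebra_simps)
    then have "norm (a - of_real t * a) = (1 - t) * norm a"
      using t by (metis abs_of_nonneg diff_ge_0_iff_ge norm_mult norm_of_real)
    also have "\<dots> \<le> norm a"
      using t by (simp add: mult_left_le_one_le)
    finally have n: "norm (a - of_real t * a) \<le> \<delta>"
      using a by simp
    have l: "lam * norm (a - of_real t * a) \<le> \<bar>lam\<bar> * 1"
      using n \<delta> by (intro mult_mono) auto
    have "of_real t * a \<in> \<Omega>"
      using assms(5) a t unfolding star_shaped_at_0_def by blast
    then have "norm (kstar a (of_real t * a)) \<le>
        M * (norm (a - of_real t * a) powr \<gamma> / norm a) * exp (lam * norm (a - of_real t * a))"
      using a by (intro assms(15)) auto
    also have "\<dots> \<le> \<bar>M\<bar> * (\<delta> powr \<gamma> / norm a) * exp \<bar>lam\<bar>"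
      using n l \<open>\<gamma> > 0\<close> by (intro mult_mono divide_right_mono powr_mono2) auto
    also have "\<dots> = C * \<delta> powr \<gamma> / norm a"
      by (simp add: C_def)
    also have "\<dots> \<le> \<kappa> / norm a"
      using \<delta>(1) by (intro divide_right_mono) auto
    finally show "norm (kstar a (of_real t * a)) \<le> \<kappa> / norm a" .
  next
    show "\<sigma> + \<kappa> < \<rho>" "\<kappa> \<ge> 0"
      unfolding \<kappa>_def using \<sigma> by (auto simp: field_simps)
  qed (use \<sigma> that in auto)
  \<comment> \<open>As \<open>0\<close> lies in the closure of \<open>\<Omega>\<close>, the open set
    on which \<open>h\<close> vanishes is nonempty, as the identity theorem on the connected set
    \<open>\<Omega>\<close> requires.\<close>
  obtain a0 where "a0 \<in> \<Omega>" "dist a0 0 < \<delta>"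
    using assms(4) \<delta>(4) unfolding closure_approachable by blast
  then have "\<Omega> \<inter> ball 0 \<delta> \<noteq> {}"
    by (auto simp: dist_commute)
  then have "h a = 0" if "a \<in> \<Omega>" for a
    using analytic_continuation_open[of "\<Omega> \<inter> ball 0 \<delta>" \<Omega> h "\<lambda>_. 0" a] assms(1)
      simply_connected_imp_connected[OF assms(2)] hol zero that
    by (auto simp: open_Int)
  then show "\<forall>a\<in>\<Omega>. f a = g a"
    by (simp add: h_def)
qed

end
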